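(* Let $p\in[0,1)$. For $n\ge0$ let $G(n)$ be the pseudofractal scale-free web, with $V_n$ vertices and $E_n$ edges, let $R(n)=R(G(n),p)$ be its all-terminal reliability, and let $$B(n)=p^{V_n-2}(1-p)^{E_n-V_n+2}\,P_n\!\left(1,\tfrac{1}{1-p}\right),$$ where $P_n(x,y)$ is the polynomial defined in the context. Then $R(0)=p^2(3-2p)$, $B(0)=p(1-p)^2$, and for every $n\ge0$ $$R(n+1)=R(n)^3+6R(n)^2B(n),\qquad B(n+1)=4R(n)B(n)^2.$$
   Context: All-terminal reliability: for a finite connected graph $G$ and $p\in[0,1]$, suppose each edge of $G$ is independently operational with probability $p$ and failed with probability $1-p$, while vertices never fail. $R(G,p)$ is the probability that any two vertices of $G$ are joined by a path of operational edges. Pseudofractal scale-free web: $G(0)$ is a triangle. For $n\ge1$, $G(n)$ is obtained from $G(n-1)$ by adding, for every edge of $G(n-1)$, one new vertex joined by new edges to both endpoints of that edge (the old edges are kept). Then $E_n=3^{n+1}$ and $V_n=\frac{3^{n+1}+3}{2}$. The three vertices of the initial triangle $G(0)$ are called the hub nodes $A,B,C$ of $G(n)$. A spanning subgraph $H$ of a graph $G$ is a subgraph with $V(H)=V(G)$. With $k(H)$ the number of connected components of $H$, put $r(H)=|V(H)|-k(H)$ and $n(H)=|E(H)|-r(H)$. Let $D_{2,n}^C$ be the set of spanning subgraphs of $G(n)$ in which the hub nodes $A$ and $B$ belong to the same connected component and $C$ belongs to a different one, and put $T_{2,n}(x,y)=\sum_{H\in D_{2,n}^C}(x-1)^{r(G(n))-r(H)}(y-1)^{n(H)}$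 (by symmetry the choice of hub $C$ is immaterial). The polynomial $x-1$ divides $T_{2,n}(x,y)$, and $P_n(x,y)$ is the polynomial with $T_{2,n}(x,y)=(x-1)P_n(x,y)$. *)

theory Defs
  imports
    "HOL-Probability.Probability"
    "HOL-Library.Uprod"
    "HOL-Computational_Algebra.Polynomial"
begin

record 'v ugraph =
  verts :: "'v set"
  edges :: "'v uprod set"

definition adjacent :: "'v ugraph \<Rightarrow> 'v \<Rightarrow> 'v \<Rightarrow> bool" where
  "adjacent G u v \<longleftrightarrow> u \<in> verts G \<and> v \<in> verts G \<and> Upair u v \<in> edges G"

definition joined :: "'v ugraph \<Rightarrow> ('v \<times> 'v) set" where
  "joined G = {(u, v). u \<in> verts G \<and> v \<in> verts G \<and> (adjacent G)\<^sup>*\<^sup>* u v}"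

definition components :: "'v ugraph \<Rightarrow> 'v set set" where
  "components G = verts G // joined G"

definition spanning_subgraphs :: "'v ugraph \<Rightarrow> 'v ugraph set" where
  "spanning_subgraphs G = {H. verts H = verts G \<and> edges H \<subseteq> edges G}"

text \<open>For a finite graph both subtractions are exact: there are at most as many components as
  vertices, and the rank (the size of a spanning forest) is at most the number of edges.\<close>

definition graph_rank :: "'v ugraph \<Rightarrow> nat" where
  "graph_rank H = card (verts H) - card (components H)"

definition nullity :: "'v ugraph \<Rightarrow> nat" where
  "nullity H = card (edges H) - graph_rank H"

definition reliability :: "'v ugraph \<Rightarrow> real \<Rightarrow> real" where
  "reliability G p =
     measure_pmf.prob (Pi_pmf (edges G) False (\<lambda>_. bernoulli_pmf p))
       {operational. \<forall>u\<in>verts G. \<forall>v\<in>verts G.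
          (u, v) \<in> joined \<lparr>verts = verts G, edges = {e \<in> edges G. operational e}\<rparr>}"

text \<open>\<open>New n e\<close> is the vertex attached to the edge \<open>e\<close> when passing from \<open>G(n)\<close> to \<open>G(n + 1)\<close>. The
  index is needed because \<open>e\<close> is kept and so receives another new vertex at every later step.\<close>

datatype web_vertex = HubA | HubB | HubC | New nat "web_vertex uprod"

primrec web :: "nat \<Rightarrow> web_vertex ugraph" where
  "web 0 = \<lparr>verts = {HubA, HubB, HubC},
            edges = {Upair HubA HubB, Upair HubB HubC, Upair HubA HubC}\<rparr>"
| "web (Suc n) =
     \<lparr>verts = verts (web n) \<union> New n ` edges (web n),
      edges = edges (web n) \<union> {Upair u (New n e) | u e. e \<in> edges (web n) \<and> u \<in> set_uprod e}\<rparr>"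

definition D2C :: "nat \<Rightarrow> web_vertex ugraph set" where
  "D2C n = {H \<in> spanning_subgraphs (web n).
              (HubA, HubB) \<in> joined H \<and> (HubA, HubC) \<notin> joined H}"

text \<open>Polynomials in \<open>x\<close> and \<open>y\<close> are of type \<open>real poly poly\<close>; \<open>x\<close> is the outer variable and the
  coefficients are polynomials in \<open>y\<close>.\<close>

definition x_minus_1 :: "real poly poly" where
  "x_minus_1 = [:-1, 1:]"

definition y_minus_1 :: "real poly poly" where
  "y_minus_1 = [:[:-1, 1:]:]"

definition eval2 :: "real poly poly \<Rightarrow> real \<Rightarrow> real \<Rightarrow> real" where
  "eval2 P x y = poly (poly P [:x:]) y"

definition T2 :: "nat \<Rightarrow> real poly poly" where
  "T2 n = (\<Sum>H\<in>D2C n. x_minus_1 ^ (graph_rank (web n) - graph_rank H) * y_minus_1 ^ nullity H)"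

definition P2 :: "nat \<Rightarrow> real poly poly" where
  "P2 n = (THE P. T2 n = x_minus_1 * P)"

definition R_web :: "real \<Rightarrow> nat \<Rightarrow> real" where
  "R_web p n = reliability (web n) p"

text \<open>The subtractions on natural numbers are exact, since \<open>2 \<le> V\<^sub>n \<le> E\<^sub>n\<close>.\<close>

definition B_web :: "real \<Rightarrow> nat \<Rightarrow> real" where
  "B_web p n =
     p ^ (card (verts (web n)) - 2)
     * (1 - p) ^ (card (edges (web n)) - card (verts (web n)) + 2)
     * eval2 (P2 n) 1 (1 / (1 - p))"

text \<open>The definite description in \<open>P2\<close> is well defined: \<open>x - 1\<close> divides \<open>T2 n\<close>, because a subgraph
  in \<open>D2C n\<close> has smaller rank than \<open>web n\<close>.\<close>

lemma equiv_joined: "equiv (verts G) (joined G)"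
proof (rule equivI)
  show "joined G \<subseteq> verts G \<times> verts G" by (auto simp: joined_def)
  show "refl_on (verts G) (joined G)" by (auto simp: refl_on_def joined_def)
  have "Upair a b = Upair b a" for a b :: 'a by simp
  then have "symp (adjacent G)" unfolding symp_def adjacent_def by metis
  then have "symp (adjacent G)\<^sup>*\<^sup>*" by (rule symp_rtranclp)
  then show "sym (joined G)" by (auto simp: sym_def joined_def dest: sympD)
  show "trans (joined G)" by (auto simp: trans_def joined_def)
qed

lemma joined_mono:
  assumes "H \<in> spanning_subgraphs G"
  shows "joined H \<subseteq> joined G"
proof -
  have "adjacent H \<le> adjacent G" using assms by (auto simp: spanning_subgraphs_def adjacent_def)
  then have "(adjacent H)\<^sup>*\<^sup>* \<le> (adjacent G)\<^sup>*\<^sup>*" by (rule rtranclp_mono)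
  then show ?thesis using assms by (auto simp: joined_def spanning_subgraphs_def)
qed

lemma graph_rank_less:
  assumes H: "H \<in> spanning_subgraphs G" and fin: "finite (verts G)"
    and uv: "(u, v) \<in> joined G" "(u, v) \<notin> joined H"
  shows "graph_rank H < graph_rank G"
proof -
  let ?f = "\<lambda>K. joined G `` K"
  have V: "verts H = verts G" using H by (simp add: spanning_subgraphs_def)
  have eH: "equiv (verts G) (joined H)" using equiv_joined[of H] V by simp
  have eG: "equiv (verts G) (joined G)" by (rule equiv_joined)
  have inV: "u \<in> verts G" "v \<in> verts G" using uv by (auto simp: joined_def)
  have cls: "?f (joined H `` {w}) = joined G `` {w}" if "w \<in> verts G" for w
  proof -
    have "joined G O joined G \<subseteq> joined G" using eG by (meson equivE trans_O_subset)
    moreover have "(w, w) \<in> joined H" using eH that by (meson equivE refl_onD)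
    ultimately show ?thesis using joined_mono[OF H] by blast
  qed
  have img: "?f ` components H = components G"
    unfolding components_def quotient_def V using cls by auto
  have finH: "finite (components H)"
    unfolding components_def V using fin eH by (simp add: finite_quotient equiv_type)
  have "\<not> inj_on ?f (components H)"
  proof
    assume inj: "inj_on ?f (components H)"
    have "joined G `` {u} = joined G `` {v}" using eG uv(1) by (rule equiv_class_eq)
    then have "?f (joined H `` {u}) = ?f (joined H `` {v})" using cls inV by simp
    then have "joined H `` {u} = joined H `` {v}"
      using inj inV unfolding components_def V inj_on_def by (metis quotientI)
    then show False using uv(2) eH inV eq_equiv_class by metis
  qed
  then have "card (components G) < card (components H)"
    using img finH card_image_le eq_card_imp_inj_on by (metis le_neq_implies_less)
  moreover have "card (components H) \<le> card (verts G)"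
  proof -
    have "components H = (\<lambda>w. joined H `` {w}) ` verts G"
      by (auto simp: components_def quotient_def V)
    then show ?thesis using fin card_image_le by metis
  qed
  ultimately show ?thesis by (simp add: graph_rank_def V)
qed

lemma finite_web: "finite (verts (web n)) \<and> finite (edges (web n))"
proof (induction n)
  case (Suc n)
  have "{Upair u (New n e) | u e. e \<in> edges (web n) \<and> u \<in> set_uprod e}
      = (\<Union>e\<in>edges (web n). (\<lambda>u. Upair u (New n e)) ` set_uprod e)" by auto
  then show ?case using Suc by simp
qed simp

lemma joined_web_hubs: "(HubA, HubC) \<in> joined (web n)"
proof -
  have "HubA \<in> verts (web n) \<and> HubC \<in> verts (web n) \<and> Upair HubA HubC \<in> edges (web n)"
    by (induction n) auto
  then show ?thesis by (auto simp: joined_def adjacent_def)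
qed

lemma x_minus_1_dvd_T2: "x_minus_1 dvd T2 n"
  unfolding T2_def
proof (rule dvd_sum)
  fix H assume "H \<in> D2C n"
  then have "graph_rank H < graph_rank (web n)"
    using graph_rank_less[of H "web n" HubA HubC] finite_web joined_web_hubs
    by (auto simp: D2C_def)
  then show "x_minus_1 dvd x_minus_1 ^ (graph_rank (web n) - graph_rank H) * y_minus_1 ^ nullity H"
    by (intro dvd_mult2 dvd_power) auto
qed

lemma T2_eq: "T2 n = x_minus_1 * P2 n"
proof -
  obtain P where P: "T2 n = x_minus_1 * P" using x_minus_1_dvd_T2[of n] by (rule dvdE)
  have "x_minus_1 \<noteq> 0" by (simp add: x_minus_1_def)
  with P have "\<exists>!P. T2 n = x_minus_1 * P" by auto
  then show ?thesis unfolding P2_def by (rule theI')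
qed

end

theory Submission
  imports Defs
begin

text \<open>Weighting operational edges by \<open>a\<close> and failed ones by \<open>b\<close> makes \<open>R(n)\<close> and \<open>B(n)\<close> values at
  \<open>(p, 1 - p)\<close> of two homogeneous polynomials \<open>R\<^sub>n(a, b)\<close> and \<open>B\<^sub>n(a, b)\<close>; the second one sums over the
  subgraphs with exactly two components, one containing \<open>A\<close> and \<open>B\<close>, the other \<open>C\<close>. Passing from
  \<open>G(n)\<close> to \<open>G(n + 1)\<close> replaces each edge by a triangle. If the new vertex of a triangle is attached to
  an end of the old edge, then the triangle acts as an operational edge with total weight
  \<open>a\<^sup>3 + 3a\<^sup>2b\<close> and as a failed one with weight \<open>2ab\<^sup>2\<close>. Hence, with
  \<open>f(a, b) = (a\<^sup>3 + 3a\<^sup>2b, 2ab\<^sup>2)\<close>, both polynomials of index \<open>n + 1\<close> are those of index \<open>n\<close> composed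
  with \<open>f\<close>. Since also \<open>(R\<^sub>0, 2B\<^sub>0) = f\<close>, the pair \<open>(R\<^sub>n, 2B\<^sub>n)\<close> is the iterate of \<open>f\<close> of order
  \<open>n + 1\<close>, and applying \<open>f\<close> on the outside instead of the inside gives the recurrence.\<close>

section \<open>Weighted sums over edge subsets\<close>

definition weight :: "'a set \<Rightarrow> real \<Rightarrow> real \<Rightarrow> 'a set \<Rightarrow> real" where
  "weight E a b F = (\<Prod>e\<in>E. if e \<in> F then a else b)"

lemma weight_Un:
  assumes "finite A" "finite B" "A \<inter> B = {}"
  shows "weight (A \<union> B) a b F = weight A a b (F \<inter> A) * weight B a b (F \<inter> B)"
  unfolding weight_def using assms by (simp add: prod.union_disjoint)

lemma weight_eq_powers:
  assumes "finite E" "F \<subseteq> E"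
  shows "weight E a b F = a ^ card F * b ^ (card E - card F)"
proof -
  have "E = F \<union> (E - F)" "finite F" using assms finite_subset by auto
  then have "weight E a b F = weight F a b F * weight (E - F) a b {}"
    using weight_Un[of F "E - F" a b F] assms by (metis Diff_disjoint finite_Diff inf.idem)
  then show ?thesis
    using assms by (simp add: weight_def card_Diff_subset \<open>finite F\<close>)
qed

text \<open>A subset of a disjoint union is a free choice of its traces on the blocks, and
  \<open>weight\<close> is multiplicative over blocks. So when the condition is imposed on each
  trace separately, the sum factors by distributivity.\<close>

lemma sum_weight_UNION:
  assumes "finite I" "\<And>i. i \<in> I \<Longrightarrow> finite (L i)" "disjoint_family_on L I"
    "\<And>i. i \<in> I \<Longrightarrow> Q i \<subseteq> Pow (L i)"
  shows "(\<Sum>X | X \<subseteq> \<Union>(L ` I) \<and> (\<forall>i\<in>I. X \<inter> L i \<in> Q i). weight (\<Union>(L ` I)) a b X)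
       = (\<Prod>i\<in>I. \<Sum>s\<in>Q i. weight (L i) a b s)"
  using assms
proof (induction I)
  case empty
  have "{X. X = {}} = {{}}" by auto
  then show ?case by (simp add: weight_def)
next
  case (insert i I)
  let ?M = "\<Union>(L ` I)" and ?S = "\<lambda>I. {X. X \<subseteq> \<Union>(L ` I) \<and> (\<forall>i\<in>I. X \<inter> L i \<in> Q i)}"
  have fin: "finite (L i)" "finite ?M" using insert by auto
  have disj: "L i \<inter> ?M = {}" using insert by (auto simp: disjoint_family_on_def)
  have Qi: "Q i \<subseteq> Pow (L i)" using insert by auto
  have IH: "(\<Sum>X\<in>?S I. weight ?M a b X) = (\<Prod>i\<in>I. \<Sum>s\<in>Q i. weight (L i) a b s)"
    using insert by (intro insert.IH) (auto simp: disjoint_family_on_def)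
  have cut: "(s \<union> X) \<inter> L j = X \<inter> L j" if "s \<in> Q i" "j \<in> I" for s X j
    using that Qi disj by blast
  have cut': "Y \<inter> ?M \<inter> L j = Y \<inter> L j" if "j \<in> I" for Y j using that by blast
  have cut2: "(s \<union> X) \<inter> L i = s" "(s \<union> X) \<inter> ?M = X" if "s \<in> Q i" "X \<subseteq> ?M" for s X
    using that Qi disj by blast+
  have "(\<Sum>X\<in>?S (insert i I). weight (\<Union>(L ` insert i I)) a b X)
      = (\<Sum>(s, X)\<in>Q i \<times> ?S I. weight (L i) a b s * weight ?M a b X)"
  \<comment> \<open>Cutting \<open>Y\<close> into its part in the new block and its part in the old
    blocks is inverse to taking the union.\<close>
  proof (rule sum.reindex_bij_witness[where i = "\<lambda>(s, X). s \<union> X" and j = "\<lambda>Y. (Y \<inter> L i, Y \<inter> ?M)"])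
    fix Y assume Y: "Y \<in> ?S (insert i I)"
    show "(case (Y \<inter> L i, Y \<inter> ?M) of (s, X) \<Rightarrow> s \<union> X) = Y" using Y by auto
    show "(Y \<inter> L i, Y \<inter> ?M) \<in> Q i \<times> ?S I" using Y cut' by auto
    show "(case (Y \<inter> L i, Y \<inter> ?M) of (s, X) \<Rightarrow> weight (L i) a b s * weight ?M a b X)
        = weight (\<Union>(L ` insert i I)) a b Y"
      using weight_Un[OF fin disj] by simp
  next
    fix z assume "z \<in> Q i \<times> ?S I"
    then obtain s X where z: "z = (s, X)" "s \<in> Q i" "X \<in> ?S I" by auto
    have X: "X \<subseteq> ?M" using z by auto
    have "s \<union> X \<subseteq> \<Union>(L ` insert i I)" using z(2) Qi X by auto
    moreover have "(s \<union> X) \<inter> L j \<in> Q j" if "j \<in> insert i I" for j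
    proof (cases "j = i")
      case True then show ?thesis using cut2(1)[OF z(2) X] z(2) by simp
    next
      case False then have "j \<in> I" using that by simp
      then show ?thesis using cut[OF z(2)] z(3) by simp
    qed
    ultimately show "(case z of (s, X) \<Rightarrow> s \<union> X) \<in> ?S (insert i I)" using z(1) by simp
    show "((case z of (s, X) \<Rightarrow> s \<union> X) \<inter> L i, (case z of (s, X) \<Rightarrow> s \<union> X) \<inter> ?M) = z"
      using cut2[OF z(2) X] z(1) by simp
  qed
  also have "\<dots> = (\<Sum>s\<in>Q i. weight (L i) a b s) * (\<Sum>X\<in>?S I. weight ?M a b X)"
    by (simp add: sum_product sum.cartesian_product)
  finally show ?case using IH insert.hyps by simp
qed

lemma sum_weight_triple:
  assumes ne: "x \<noteq> y" "x \<noteq> z" "y \<noteq> z"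
  shows "(\<Sum>s | s \<subseteq> {x, y, z} \<and> P s. weight {x, y, z} a b s)
       = (if P {} then b ^ 3 else 0)
       + (if P {x} then a * b\<^sup>2 else 0) + (if P {y} then a * b\<^sup>2 else 0) + (if P {z} then a * b\<^sup>2 else 0)
       + (if P {x, y} then a\<^sup>2 * b else 0) + (if P {x, z} then a\<^sup>2 * b else 0)
       + (if P {y, z} then a\<^sup>2 * b else 0) + (if P {x, y, z} then a ^ 3 else 0)"
proof -
  have "Pow {x, y, z} = {{}, {x}, {y}, {z}, {x, y}, {x, z}, {y, z}, {x, y, z}}"
    by (auto simp: Pow_insert)
  moreover have "{x, y} \<noteq> {x, z}" "{x, y} \<noteq> {y, z}" "{x, y} \<noteq> {x, y, z}" "{x, z} \<noteq> {y, z}"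
    "{x, z} \<noteq> {x, y, z}" "{y, z} \<noteq> {x, y, z}"
    using ne by (auto simp: set_eq_iff)
  moreover have "(\<Sum>s | s \<subseteq> {x, y, z} \<and> P s. weight {x, y, z} a b s)
      = (\<Sum>s\<in>Pow {x, y, z}. if P s then weight {x, y, z} a b s else 0)"
    by (subst sum.inter_filter[symmetric]) (auto intro: sum.cong)
  ultimately show ?thesis
    using ne by (simp add: weight_def power2_eq_square power3_eq_cube algebra_simps)
qed

text \<open>An equivalence that relates the images of adjacent vertices relates the images of the
  ends of any path. With \<open>r = Id\<close> this serves to refute joinedness: a labelling that is
  constant on edges separates vertices with different labels.\<close>

lemma joined_map:
  assumes uv: "(u, v) \<in> joined G"
    and r: "equiv W r" and h: "h ` verts G \<subseteq> W"
    and adj: "\<And>x y. adjacent G x y \<Longrightarrow> (h x, h y) \<in> r"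
  shows "(h u, h v) \<in> r"
proof -
  have "u \<in> verts G" "(adjacent G)\<^sup>*\<^sup>* u v" using uv by (auto simp: joined_def)
  from this(2) show ?thesis
  proof induction
    case base
    show ?case using r h \<open>u \<in> verts G\<close> by (auto simp: equiv_def refl_on_def)
  next
    case (step y z)
    then show ?case using adj r by (meson equivE transD)
  qed
qed

text \<open>With \<open>S\<close> a single hub this is connectedness; with two hubs it bounds the
  number of components by two. One notion covers both sums, so the triangle replacement is analysed
  only once.\<close>

definition spans :: "'v ugraph \<Rightarrow> 'v set \<Rightarrow> bool" where
  "spans G S \<longleftrightarrow> (\<forall>v\<in>verts G. \<exists>s\<in>S. (s, v) \<in> joined G)"

section \<open>Replacing every edge by a triangle\<close>

locale edge_apexes =
  fixes V :: "'v set" and E :: "'v uprod set" and apex :: "'v uprod \<Rightarrow> 'v"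
  assumes finite_edges: "finite E"
    and edge_ends: "e \<in> E \<Longrightarrow> \<exists>u v. e = Upair u v \<and> u \<noteq> v \<and> u \<in> V \<and> v \<in> V"
    and apex_fresh: "e \<in> E \<Longrightarrow> apex e \<notin> V"
    and inj_apex: "inj_on apex E"
begin

abbreviation "V' \<equiv> V \<union> apex ` E"

definition triangle :: "'v uprod \<Rightarrow> 'v uprod set" where
  "triangle e = insert e ((\<lambda>u. Upair u (apex e)) ` set_uprod e)"

abbreviation "E' \<equiv> \<Union>(triangle ` E)"

definition attached :: "'v uprod set \<Rightarrow> bool" where
  "attached F \<longleftrightarrow> (\<forall>e\<in>E. \<exists>u\<in>set_uprod e. Upair u (apex e) \<in> F)"

text \<open>If all apexes are attached, \<open>core F\<close> consists of the edges whose ends are joined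
  inside their own triangle.\<close>

definition core :: "'v uprod set \<Rightarrow> 'v uprod set" where
  "core F = {e \<in> E. e \<in> F \<or> (\<forall>u\<in>set_uprod e. Upair u (apex e) \<in> F)}"

lemma set_edge_subset: "e \<in> E \<Longrightarrow> set_uprod e \<subseteq> V"
  using edge_ends[of e] by auto

lemma half_edge_notin: "e \<in> E \<Longrightarrow> Upair u (apex e) \<notin> E"
  using set_edge_subset apex_fresh by fastforce

text \<open>An edge at \<open>apex e\<close> cannot be an old edge, since apexes lie outside
  \<open>V\<close>; so it is a half-edge of \<open>d\<close>, and injectivity of \<open>apex\<close>
  identifies \<open>d\<close> with \<open>e\<close>.\<close>

lemma half_edge_in_triangle:
  assumes "d \<in> E" "e \<in> E" "Upair u (apex e) \<in> triangle d"
  shows "d = e \<and> u \<in> set_uprod e"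
proof -
  have "Upair u (apex e) \<noteq> d" using half_edge_notin assms by metis
  then obtain w where w: "w \<in> set_uprod d" "Upair u (apex e) = Upair w (apex d)"
    using assms(3) by (auto simp: triangle_def)
  have "w \<noteq> apex e" using w assms set_edge_subset apex_fresh by blast
  then have "u = w" "apex d = apex e" using w(2) by auto
  then show ?thesis using inj_apex assms w by (metis inj_onD)
qed

lemma disjoint_triangles: "disjoint_family_on triangle E"
proof -
  have "d = e" if "d \<in> E" "e \<in> E" "x \<in> triangle d" "x \<in> triangle e" for d e x
  proof (cases "x \<in> E")
    case True
    then show ?thesis using that half_edge_notin by (auto simp: triangle_def)
  next
    case False
    then have "x \<in> (\<lambda>u. Upair u (apex e)) ` set_uprod e"
      using that by (auto simp: triangle_def)
    then obtain u where "x = Upair u (apex e)" by blast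
    then show ?thesis using half_edge_in_triangle that by metis
  qed
  then show ?thesis by (auto simp: disjoint_family_on_def)
qed

text \<open>Here \<open>h\<close> is a retraction onto the old vertices that collapses each apex
  into an end to which it is attached. Each edge of \<open>F\<close> then becomes a point or an edge
  of \<open>core F\<close>.\<close>

lemma adjacent_core:
  assumes F: "F \<subseteq> E'"
    and att: "attached F"
    and h: "\<And>x. x \<in> V \<Longrightarrow> h x = x"
      "\<And>e. e \<in> E \<Longrightarrow> h (apex e) \<in> set_uprod e \<and> Upair (h (apex e)) (apex e) \<in> F"
    and xy: "Upair x y \<in> F"
  shows "(h x, h y) \<in> joined \<lparr>verts = V, edges = core F\<rparr>"
proof -
  let ?J = "joined \<lparr>verts = V, edges = core F\<rparr>"
  have eq: "equiv V ?J" using equiv_joined[of "\<lparr>verts = V, edges = core F\<rparr>"] by simp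
  have adj: "(u, v) \<in> ?J" if "Upair u v \<in> core F" for u v
  proof -
    have "u \<in> V \<and> v \<in> V" using that set_edge_subset by (fastforce simp: core_def)
    then show ?thesis using that by (auto simp: joined_def adjacent_def)
  qed
  have half: "(u, h (apex e)) \<in> ?J" if e: "e \<in> E" "u \<in> set_uprod e" "Upair u (apex e) \<in> F" for u e
  proof (cases "u = h (apex e)")
    case True
    then show ?thesis using eq e set_edge_subset by (metis equivE refl_onD subsetD)
  next
    \<comment> \<open>The apex is collapsed into the other end of \<open>e\<close>, so both
      half-edges are in \<open>F\<close> and \<open>e\<close> belongs to the core.\<close>
    case False
    then have e_eq: "e = Upair u (h (apex e))"
      using e h(2)[OF e(1)] edge_ends[OF e(1)] by auto
    then have "set_uprod e = {u, h (apex e)}" by (metis set_uprod_simps)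
    then have "e \<in> core F" using e h(2)[OF e(1)] by (simp add: core_def)
    then show ?thesis using adj e_eq by metis
  qed
  obtain e where e: "e \<in> E" "Upair x y \<in> triangle e" using F xy by auto
  show ?thesis
  proof (cases "Upair x y = e")
    case True
    then have "x \<in> V" "y \<in> V" using set_edge_subset[OF e(1)] by auto
    moreover have "Upair x y \<in> core F" using True e xy by (simp add: core_def)
    ultimately show ?thesis using adj h by simp
  next
    case False
    then obtain u where u: "u \<in> set_uprod e" "Upair x y = Upair u (apex e)"
      using e by (auto simp: triangle_def)
    have "u \<in> V" using u e set_edge_subset by auto
    moreover have "Upair u (apex e) \<in> F" using u(2) xy by metis
    ultimately have "(h u, h (apex e)) \<in> ?J" using half[OF e(1) u(1)] h(1) by simp
    moreover from this have "(h (apex e), h u) \<in> ?J" using eq by (meson equivE symD)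
    ultimately show ?thesis using u(2) by auto
  qed
qed

lemma attached_apexE:
  assumes "attached F"
  obtains h where "\<And>x. x \<in> V \<Longrightarrow> h x = x"
      "\<And>e. e \<in> E \<Longrightarrow> h (apex e) \<in> set_uprod e \<and> Upair (h (apex e)) (apex e) \<in> F"
proof -
  obtain g where g: "\<And>e. e \<in> E \<Longrightarrow> g e \<in> set_uprod e \<and> Upair (g e) (apex e) \<in> F"
    using assms unfolding attached_def by metis
  let ?h = "\<lambda>x. if x \<in> V then x else g (inv_into E apex x)"
  show thesis
    by (rule that[of ?h]) (use g apex_fresh inj_apex in auto)
qed

text \<open>Paths in \<open>F\<close> are pushed to the core by the retraction. Conversely, a core
  edge missing from \<open>F\<close> is replaced by the detour through its apex.\<close>

lemma joined_core_iff:
  assumes F: "F \<subseteq> E'" and att: "attached F" and uv: "u \<in> V" "v \<in> V"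
  shows "(u, v) \<in> joined \<lparr>verts = V', edges = F\<rparr> \<longleftrightarrow> (u, v) \<in> joined \<lparr>verts = V, edges = core F\<rparr>"
    (is "?l \<longleftrightarrow> ?r")
proof
  obtain h where h: "\<And>x. x \<in> V \<Longrightarrow> h x = x"
      "\<And>e. e \<in> E \<Longrightarrow> h (apex e) \<in> set_uprod e \<and> Upair (h (apex e)) (apex e) \<in> F"
    using attached_apexE[OF att] by metis
  assume ?l
  then have "(h u, h v) \<in> joined \<lparr>verts = V, edges = core F\<rparr>"
  proof (rule joined_map)
    show "equiv V (joined \<lparr>verts = V, edges = core F\<rparr>)"
      using equiv_joined[of "\<lparr>verts = V, edges = core F\<rparr>"] by simp
    show "h ` verts \<lparr>verts = V', edges = F\<rparr> \<subseteq> V" using h set_edge_subset by fastforce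
  qed (use adjacent_core[OF F att h] in \<open>auto simp: adjacent_def\<close>)
  then show ?r using h uv by simp
next
  let ?J = "joined \<lparr>verts = V', edges = F\<rparr>"
  have eq: "equiv V' ?J" using equiv_joined[of "\<lparr>verts = V', edges = F\<rparr>"] by simp
  assume ?r
  then have "(id u, id v) \<in> ?J"
  proof (rule joined_map)
    show "equiv V' ?J" by (fact eq)
    fix x y assume "adjacent \<lparr>verts = V, edges = core F\<rparr> x y"
    then have xy: "x \<in> V" "y \<in> V" "Upair x y \<in> E"
      "Upair x y \<in> F \<or> Upair x (apex (Upair x y)) \<in> F \<and> Upair y (apex (Upair x y)) \<in> F"
      by (auto simp: adjacent_def core_def)
    have step: "(s, t) \<in> ?J" if "s \<in> V'" "t \<in> V'" "Upair s t \<in> F" for s t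
      using that by (auto simp: joined_def adjacent_def)
    have "(x, y) \<in> ?J" if "Upair x (apex (Upair x y)) \<in> F" "Upair y (apex (Upair x y)) \<in> F"
    proof -
      have "(x, apex (Upair x y)) \<in> ?J" "(y, apex (Upair x y)) \<in> ?J"
        using that xy by (auto intro!: step)
      then show ?thesis using eq by (meson equivE symD transD)
    qed
    then show "(id x, id y) \<in> ?J" using xy step by auto
  qed auto
  then show ?l by simp
qed

text \<open>An attached apex is reached through its end in \<open>V\<close>. An unattached one is an
  isolated vertex outside \<open>S\<close>, which nothing in \<open>S\<close> reaches.\<close>

lemma spans_core_iff:
  assumes F: "F \<subseteq> E'" and S: "S \<subseteq> V"
  shows "spans \<lparr>verts = V', edges = F\<rparr> S \<longleftrightarrow> attached F \<and> spans \<lparr>verts = V, edges = core F\<rparr> S"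
proof (cases "attached F")
  case True
  let ?J = "joined \<lparr>verts = V', edges = F\<rparr>"
  have eq: "equiv V' ?J" using equiv_joined[of "\<lparr>verts = V', edges = F\<rparr>"] by simp
  have "\<exists>s\<in>S. (s, apex e) \<in> ?J"
    if sp: "spans \<lparr>verts = V, edges = core F\<rparr> S" and e: "e \<in> E" for e
  proof -
    obtain u where u: "u \<in> set_uprod e" "Upair u (apex e) \<in> F"
      using True e by (auto simp: attached_def)
    have uV: "u \<in> V" using u e set_edge_subset by auto
    then have "(u, apex e) \<in> ?J" using u e by (auto simp: joined_def adjacent_def)
    moreover obtain s where s: "s \<in> S" "(s, u) \<in> joined \<lparr>verts = V, edges = core F\<rparr>"
      using sp uV by (auto simp: spans_def)
    then have "(s, u) \<in> ?J" using joined_core_iff[OF F True] S uV by blast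
    ultimately show ?thesis using s eq by (meson equivE transD)
  qed
  moreover have "(\<exists>s\<in>S. (s, v) \<in> ?J) \<longleftrightarrow> (\<exists>s\<in>S. (s, v) \<in> joined \<lparr>verts = V, edges = core F\<rparr>)"
    if "v \<in> V" for v using joined_core_iff[OF F True] that S by blast
  ultimately show ?thesis using True by (auto simp: spans_def)
next
  case False
  then obtain e where e: "e \<in> E" "\<And>u. u \<in> set_uprod e \<Longrightarrow> Upair u (apex e) \<notin> F"
    by (auto simp: attached_def)
  have isolated: "Upair u (apex e) \<notin> F" for u
    using half_edge_in_triangle[OF _ e(1)] e F by blast
  \<comment> \<open>The last edge of a nontrivial path to the apex would be a half-edge in
    \<open>F\<close>.\<close>
  have "s = apex e" if "(adjacent \<lparr>verts = V', edges = F\<rparr>)\<^sup>*\<^sup>* s (apex e)" for s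
    using that by (cases rule: rtranclp.cases) (auto simp: adjacent_def isolated)
  then have "(s, apex e) \<notin> joined \<lparr>verts = V', edges = F\<rparr>" if "s \<in> S" for s
    using that S apex_fresh[OF e(1)] unfolding joined_def by blast
  then have "\<not> spans \<lparr>verts = V', edges = F\<rparr> S" using e(1) unfolding spans_def by fastforce
  then show ?thesis using False by simp
qed

lemma triangle_eq:
  assumes e: "e \<in> E"
  obtains u v x y where "e = Upair u v" "x = Upair u (apex e)" "y = Upair v (apex e)"
    "triangle e = {e, x, y}" "e \<noteq> x" "e \<noteq> y" "x \<noteq> y"
proof -
  obtain u v where uv: "e = Upair u v" "u \<noteq> v" "u \<in> V" "v \<in> V" using edge_ends[OF e] by auto
  show thesis
    by (rule that[OF uv(1) refl refl])
      (use uv half_edge_notin[OF e] e apex_fresh[OF e] in \<open>auto simp: triangle_def\<close>)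
qed

lemma card_E': "card E' = 3 * card E"
proof -
  have "card (triangle e) = 3" if "e \<in> E" for e
    using triangle_eq[OF that] by (metis card_3_iff)
  then show ?thesis
    using finite_edges disjoint_triangles
    by (subst card_UN_disjoint) (auto simp: disjoint_family_on_def triangle_def)
qed

text \<open>Of the eight states of a triangle, two leave the apex isolated. The ends are joined when
  all three edges or exactly two are present; they are separated, with the apex attached, when
  exactly one half-edge is the only edge present.\<close>

lemma sum_weight_local:
  assumes e: "e \<in> E"
  shows "(\<Sum>s | s \<subseteq> triangle e \<and> (\<exists>u\<in>set_uprod e. Upair u (apex e) \<in> s)
            \<and> ((e \<in> s \<or> (\<forall>u\<in>set_uprod e. Upair u (apex e) \<in> s)) \<longleftrightarrow> c). weight (triangle e) a b s)
       = (if c then a ^ 3 + 3 * a\<^sup>2 * b else 2 * a * b\<^sup>2)"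
proof -
  obtain u v x y where e_eq: "e = Upair u v" and xy: "x = Upair u (apex e)" "y = Upair v (apex e)"
    and T: "triangle e = {e, x, y}" and ne: "e \<noteq> x" "e \<noteq> y" "x \<noteq> y"
    using triangle_eq[OF e] by metis
  have "set_uprod e = {u, v}" using e_eq by simp
  then have "(\<exists>u\<in>set_uprod e. Upair u (apex e) \<in> s) \<longleftrightarrow> x \<in> s \<or> y \<in> s"
    "(\<forall>u\<in>set_uprod e. Upair u (apex e) \<in> s) \<longleftrightarrow> x \<in> s \<and> y \<in> s" for s
    by (simp_all add: xy)
  then show ?thesis unfolding T using ne by (simp add: sum_weight_triple)
qed

text \<open>The sets \<open>F\<close> are grouped by their core \<open>H\<close>. Once
  \<open>H\<close> is fixed, being attached and having core \<open>H\<close> are independent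
  conditions on the single triangles, so the group sums to a product over the old edges, which is
  again a weight of \<open>H\<close>.\<close>

lemma sum_weight_core:
  fixes Q :: "'v uprod set \<Rightarrow> bool"
  assumes Q': "\<And>F. F \<subseteq> E' \<Longrightarrow> Q' F \<longleftrightarrow> attached F \<and> Q (core F)"
  shows "(\<Sum>F | F \<subseteq> E' \<and> Q' F. weight E' a b F)
       = (\<Sum>H | H \<subseteq> E \<and> Q H. weight E (a ^ 3 + 3 * a\<^sup>2 * b) (2 * a * b\<^sup>2) H)"
proof -
  let ?att = "\<lambda>e s. \<exists>u\<in>set_uprod e. Upair u (apex e) \<in> s"
  let ?thru = "\<lambda>e s. e \<in> s \<or> (\<forall>u\<in>set_uprod e. Upair u (apex e) \<in> s)"
  let ?Q = "\<lambda>H e. {s. s \<subseteq> triangle e \<and> ?att e s \<and> (?thru e s \<longleftrightarrow> e \<in> H)}"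
  have fin_tri: "finite (triangle e)" for e by (simp add: triangle_def)
  have finE': "finite E'" using finite_edges fin_tri by auto
  have att: "attached F \<longleftrightarrow> (\<forall>e\<in>E. ?att e (F \<inter> triangle e))" for F
    unfolding attached_def triangle_def by blast
  have core: "core F = H \<longleftrightarrow> (\<forall>e\<in>E. ?thru e (F \<inter> triangle e) \<longleftrightarrow> e \<in> H)" if "H \<subseteq> E" for F H
  proof -
    have "?thru e (F \<inter> triangle e) \<longleftrightarrow> ?thru e F" for e
      unfolding triangle_def by blast
    then show ?thesis using that unfolding core_def by blast
  qed
  have "(\<Sum>F | F \<subseteq> E' \<and> Q' F. weight E' a b F)
      = (\<Sum>H | H \<subseteq> E \<and> Q H. \<Sum>F\<in>{F \<in> {F. F \<subseteq> E' \<and> Q' F}. core F = H}. weight E' a b F)"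
    by (rule sum.group[symmetric]) (use finE' finite_edges Q' in \<open>auto simp: core_def\<close>)
  also have "\<dots> = (\<Sum>H | H \<subseteq> E \<and> Q H. weight E (a ^ 3 + 3 * a\<^sup>2 * b) (2 * a * b\<^sup>2) H)"
  proof (rule sum.cong[OF refl])
    fix H assume "H \<in> {H. H \<subseteq> E \<and> Q H}"
    then have H: "H \<subseteq> E" "Q H" by auto
    have "{F \<in> {F. F \<subseteq> E' \<and> Q' F}. core F = H} = {F. F \<subseteq> E' \<and> attached F \<and> core F = H}"
      using Q' H by auto
    also have "\<dots> = {F. F \<subseteq> E' \<and> (\<forall>e\<in>E. F \<inter> triangle e \<in> ?Q H e)}"
      unfolding core[OF H(1)] att by blast
    finally have "(\<Sum>F\<in>{F \<in> {F. F \<subseteq> E' \<and> Q' F}. core F = H}. weight E' a b F)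
        = (\<Sum>F | F \<subseteq> E' \<and> (\<forall>e\<in>E. F \<inter> triangle e \<in> ?Q H e). weight E' a b F)"
      by simp
    also have "\<dots> = (\<Prod>e\<in>E. \<Sum>s\<in>?Q H e. weight (triangle e) a b s)"
      by (rule sum_weight_UNION) (use finite_edges fin_tri disjoint_triangles in auto)
    also have "\<dots> = weight E (a ^ 3 + 3 * a\<^sup>2 * b) (2 * a * b\<^sup>2) H"
      unfolding weight_def[of E] by (rule prod.cong[OF refl]) (rule sum_weight_local)
    finally show "(\<Sum>F\<in>{F \<in> {F. F \<subseteq> E' \<and> Q' F}. core F = H}. weight E' a b F)
        = weight E (a ^ 3 + 3 * a\<^sup>2 * b) (2 * a * b\<^sup>2) H" .
  qed
  finally show ?thesis .
qed

end

section \<open>Reliability as a weighted sum\<close>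

lemma reliability_eq_sum_weight:
  assumes fin: "finite (edges G)" and p: "0 \<le> p" "p \<le> 1"
  shows "reliability G p
    = (\<Sum>F | F \<subseteq> edges G \<and> (\<forall>u\<in>verts G. \<forall>v\<in>verts G. (u, v) \<in> joined \<lparr>verts = verts G, edges = F\<rparr>).
         weight (edges G) p (1 - p) F)"
proof -
  let ?E = "edges G" and ?g = "\<lambda>F e. e \<in> F"
  let ?M = "Pi_pmf ?E False (\<lambda>_. bernoulli_pmf p)"
  let ?C = "\<lambda>F. \<forall>u\<in>verts G. \<forall>v\<in>verts G. (u, v) \<in> joined \<lparr>verts = verts G, edges = F\<rparr>"
  let ?S = "{F. F \<subseteq> ?E \<and> ?C F}"
  have "reliability G p = measure_pmf.prob ?M (?g ` ?S)"
    unfolding reliability_def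
  \<comment> \<open>The product distribution lives on functions, but those that are not
    \<open>False\<close> outside the edge set have probability 0. The others are exactly the
    indicators of edge subsets.\<close>
  proof (rule measure_prob_cong_0)
    fix f assume "f \<in> {f. ?C {e \<in> ?E. f e}} - ?g ` ?S"
    then have f: "?C {e \<in> ?E. f e}" "f \<notin> ?g ` ?S" by auto
    have "f \<noteq> ?g {e \<in> ?E. f e}" using f by blast
    then obtain e where "e \<notin> ?E" "f e \<noteq> False" by (auto simp: fun_eq_iff)
    then show "pmf ?M f = 0" using fin by (auto intro!: pmf_Pi_outside)
  next
    fix f assume f: "f \<in> ?g ` ?S - {f. ?C {e \<in> ?E. f e}}"
    then obtain F where F: "F \<subseteq> ?E" "?C F" "f = ?g F" by auto
    then have "{e \<in> ?E. f e} = F" by auto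
    then show "pmf ?M f = 0" using f F(2) by simp
  qed
  also have "\<dots> = sum (pmf ?M) (?g ` ?S)"
    using fin by (intro measure_measure_pmf_finite) auto
  also have "\<dots> = (\<Sum>F\<in>?S. pmf ?M (?g F))"
    by (subst sum.reindex) (auto simp: inj_on_def fun_eq_iff)
  also have "\<dots> = (\<Sum>F\<in>?S. weight ?E p (1 - p) F)"
  proof (rule sum.cong[OF refl])
    fix F assume "F \<in> ?S"
    then have "pmf ?M (?g F) = (\<Prod>e\<in>?E. pmf (bernoulli_pmf p) (e \<in> F))"
      using fin by (intro pmf_Pi') auto
    also have "\<dots> = weight ?E p (1 - p) F"
      unfolding weight_def using p by (intro prod.cong) auto
    finally show "pmf ?M (?g F) = weight ?E p (1 - p) F" .
  qed
  finally show ?thesis .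
qed

section \<open>Spanning sets, component counts and edge counts\<close>

lemma joined_all_iff_spans:
  assumes "s \<in> verts G"
  shows "(\<forall>u\<in>verts G. \<forall>v\<in>verts G. (u, v) \<in> joined G) \<longleftrightarrow> spans G {s}"
proof -
  have "sym (joined G)" "trans (joined G)" using equiv_joined[of G] by (auto elim: equivE)
  then have "(u, v) \<in> joined G" if "(s, u) \<in> joined G" "(s, v) \<in> joined G" for u v
    using that by (meson symD transD)
  then show ?thesis using assms by (auto simp: spans_def)
qed

text \<open>Start with all labels distinct and add the edges one at a time. Each new edge merges at
  most two labels, so it costs at most one.\<close>

lemma ex_labelling_constant_on_edges:
  fixes V :: "'v set"
  assumes "finite V" "finite F"
  shows "\<exists>c :: 'v \<Rightarrow> 'v. (\<forall>x y. Upair x y \<in> F \<longrightarrow> c x = c y) \<and> card V \<le> card (c ` V) + card F"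
  using assms(2)
proof induction
  case empty
  show ?case by (rule exI[of _ id]) simp
next
  case (insert e F)
  then obtain c :: "'v \<Rightarrow> 'v" where c: "\<And>x y. Upair x y \<in> F \<Longrightarrow> c x = c y"
    "card V \<le> card (c ` V) + card F" by auto
  obtain u v where e: "e = Upair u v" by (cases e) auto
  define d where "d x = (if c x = c u then c v else c x)" for x
  have "card (c ` V) \<le> card (insert (c u) (d ` V))"
    using assms by (intro card_mono) (auto simp: d_def)
  also have "\<dots> \<le> Suc (card (d ` V))" by (rule card_insert_le_m1) simp_all
  finally have "card V \<le> card (d ` V) + card (insert e F)" using c insert by simp
  moreover have "d x = d y" if "Upair x y \<in> insert e F" for x y
    using that c(1)[of x y] by (auto simp: e d_def)
  ultimately show ?case by blast
qed

text \<open>A labelling constant on edges is constant on components, so it takes at most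
  \<open>card S\<close> values. With two hubs as \<open>S\<close> this gives
  \<open>V - 2 <= card F\<close>, which makes the exponent subtraction in the sum for
  \<open>B(n)\<close> exact.\<close>

lemma card_verts_le_spans:
  fixes G :: "'v ugraph"
  assumes fin: "finite (verts G)" "finite (edges G)" "finite S" and sp: "spans G S"
  shows "card (verts G) \<le> card S + card (edges G)"
proof -
  obtain c :: "'v \<Rightarrow> 'v" where c: "\<And>x y. Upair x y \<in> edges G \<Longrightarrow> c x = c y"
    "card (verts G) \<le> card (c ` verts G) + card (edges G)"
    using ex_labelling_constant_on_edges[OF fin(1,2)] by metis
  have "c s = c v" if "(s, v) \<in> joined G" for s v
    using joined_map[OF that, of UNIV Id c] c(1)
    by (auto simp: adjacent_def equiv_def refl_on_def sym_def trans_def)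
  then have "\<exists>s\<in>S. c v = c s" if "v \<in> verts G" for v
    using sp that by (metis spans_def)
  then have "c ` verts G \<subseteq> c ` S" by auto
  then have "card (c ` verts G) \<le> card S"
    using fin(3) by (meson card_image_le card_mono finite_imageI le_trans)
  then show ?thesis using c(2) by simp
qed

lemma components_eq_if_spans:
  assumes "spans G S" "S \<subseteq> verts G"
  shows "components G = (\<lambda>s. joined G `` {s}) ` S"
proof -
  have "\<exists>s\<in>S. joined G `` {v} = joined G `` {s}" if "v \<in> verts G" for v
    using assms(1) that equiv_class_eq[OF equiv_joined] unfolding spans_def by metis
  then have "(\<lambda>v. joined G `` {v}) ` verts G = (\<lambda>s. joined G `` {s}) ` S"
    using assms(2) by (simp add: set_eq_iff image_iff) blast
  moreover have "components G = (\<lambda>v. joined G `` {v}) ` verts G"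
    by (auto simp: components_def quotient_def)
  ultimately show ?thesis by simp
qed

text \<open>The classes of \<open>s\<close> and \<open>t\<close> are already two distinct
  components; having no others means that these two vertices span.\<close>

lemma card_components_if_not_joined:
  assumes fin: "finite (verts G)" and st: "s \<in> verts G" "t \<in> verts G" "(s, t) \<notin> joined G"
  shows "2 \<le> card (components G)" "card (components G) \<le> 2 \<longleftrightarrow> spans G {s, t}"
    "card (components G) \<le> card (verts G)"
proof -
  have eq: "equiv (verts G) (joined G)" by (rule equiv_joined)
  have ne: "joined G `` {s} \<noteq> joined G `` {t}" using eq st by (metis eq_equiv_class)
  have comp: "components G = (\<lambda>v. joined G `` {v}) ` verts G"
    by (auto simp: components_def quotient_def)
  have finC: "finite (components G)" using fin by (simp add: comp)
  have sub: "{joined G `` {s}, joined G `` {t}} \<subseteq> components G" using st by (auto simp: comp)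
  have c2: "card {joined G `` {s}, joined G `` {t}} = 2" using ne by simp
  show "2 \<le> card (components G)" using card_mono[OF finC sub] c2 by simp
  show "card (components G) \<le> card (verts G)" using fin by (simp add: comp card_image_le)
  show "card (components G) \<le> 2 \<longleftrightarrow> spans G {s, t}"
  proof
    assume "card (components G) \<le> 2"
    then have all: "components G = {joined G `` {s}, joined G `` {t}}"
      using card_seteq[OF finC sub] c2 by simp
    have "(s, v) \<in> joined G \<or> (t, v) \<in> joined G" if "v \<in> verts G" for v
    proof -
      have "joined G `` {v} \<in> components G" using that by (simp add: comp)
      then have "joined G `` {v} = joined G `` {s} \<or> joined G `` {v} = joined G `` {t}"
        using all by auto
      then show ?thesis using eq that st by (metis eq_equiv_class)
    qed
    then show "spans G {s, t}" by (auto simp: spans_def)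
  next
    assume "spans G {s, t}"
    then have "components G = {joined G `` {s}, joined G `` {t}}"
      using components_eq_if_spans[of G "{s, t}"] st by simp
    then show "card (components G) \<le> 2" using c2 by simp
  qed
qed

lemma joined_three_vertices_iff:
  assumes "u \<noteq> v" "u \<noteq> w" "v \<noteq> w"
  shows "(u, v) \<in> joined \<lparr>verts = {u, v, w}, edges = F\<rparr>
    \<longleftrightarrow> Upair u v \<in> F \<or> Upair u w \<in> F \<and> Upair w v \<in> F" (is "?l \<longleftrightarrow> ?r")
proof
  have eq: "equiv UNIV (Id :: (bool \<times> bool) set)"
    by (auto simp: equiv_def refl_on_def sym_def trans_def)
  assume l: ?l
  show ?r
  proof (rule ccontr)
    assume nr: "\<not> ?r"
    have comm: "Upair v u = Upair u v" "Upair w u = Upair u w" "Upair v w = Upair w v" by simp_all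
    show False
    proof (cases "Upair u w \<in> F")
      case True
      have "(u = v, v = v) \<in> Id"
        \<comment> \<open>Neither edge at \<open>v\<close> is present, so being equal to
          \<open>v\<close> is a truth-valued label constant on edges. In the other case
          \<open>u\<close> is the isolated vertex.\<close>
        by (rule joined_map[OF l eq])
          (use nr True assms comm in \<open>auto simp: adjacent_def simp del: Upair_inject\<close>)
      then show False using assms by simp
    next
      case False
      have "(u = u, v = u) \<in> Id"
        by (rule joined_map[OF l eq])
          (use nr False assms comm in \<open>auto simp: adjacent_def simp del: Upair_inject\<close>)
      then show False using assms by simp
    qed
  qed
next
  let ?G = "\<lparr>verts = {u, v, w}, edges = F\<rparr>"
  assume ?r
  then have "adjacent ?G u v \<or> adjacent ?G u w \<and> adjacent ?G w v" by (auto simp: adjacent_def)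
  then have "(adjacent ?G)\<^sup>*\<^sup>* u v" by (meson r_into_rtranclp rtranclp_trans)
  then show ?l by (simp add: joined_def)
qed

section \<open>The web as an instance of triangle replacement\<close>

lemma New_in_web: "New k e \<in> verts (web n) \<Longrightarrow> k < n"
  by (induction n) auto

lemma edge_ends_web:
  "e \<in> edges (web n) \<Longrightarrow> \<exists>u v. e = Upair u v \<and> u \<noteq> v \<and> u \<in> verts (web n) \<and> v \<in> verts (web n)"
proof (induction n arbitrary: e)
  case 0
  then show ?case by auto
next
  case (Suc n)
  consider "e \<in> edges (web n)"
    | u d where "e = Upair u (New n d)" "d \<in> edges (web n)" "u \<in> set_uprod d"
    using Suc.prems by auto
  then show ?case
  proof cases
    case 1
    then show ?thesis using Suc.IH by fastforce
  next
    case 2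
    then have "u \<in> verts (web n)" using Suc.IH[OF 2(2)] by auto
    moreover from this have "u \<noteq> New n d" using New_in_web by blast
    ultimately show ?thesis using 2 by auto
  qed
qed

interpretation web: edge_apexes "verts (web n)" "edges (web n)" "New n" for n
  by standard (auto simp: inj_on_def finite_web intro: edge_ends_web dest: New_in_web)

lemma edges_web_Suc: "edges (web (Suc n)) = \<Union>(web.triangle n ` edges (web n))"
  by (auto simp: web.triangle_def)

lemma hubs_in_web: "HubA \<in> verts (web n)" "HubB \<in> verts (web n)" "HubC \<in> verts (web n)"
  by (induction n) auto

abbreviation subweb :: "nat \<Rightarrow> web_vertex uprod set \<Rightarrow> web_vertex ugraph" where
  "subweb n F \<equiv> \<lparr>verts = verts (web n), edges = F\<rparr>"

text \<open>The polynomial \<open>R\<^sub>n(a, b)\<close>, kept as a function of two free weights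
  because the recursion changes the weights.\<close>

definition connected_sum :: "nat \<Rightarrow> real \<Rightarrow> real \<Rightarrow> real" where
  "connected_sum n a b =
     (\<Sum>F | F \<subseteq> edges (web n) \<and> spans (subweb n F) {HubA}. weight (edges (web n)) a b F)"

text \<open>The spanning condition allows at most two components, and separating the hubs makes it
  exactly two.\<close>

definition splits :: "web_vertex ugraph \<Rightarrow> bool" where
  "splits H \<longleftrightarrow> spans H {HubA, HubC} \<and> (HubA, HubB) \<in> joined H \<and> (HubA, HubC) \<notin> joined H"

definition split_sum :: "nat \<Rightarrow> real \<Rightarrow> real \<Rightarrow> real" where
  "split_sum n a b =
     (\<Sum>F | F \<subseteq> edges (web n) \<and> splits (subweb n F). weight (edges (web n)) a b F)"

lemma connected_sum_Suc:
  "connected_sum (Suc n) a b = connected_sum n (a ^ 3 + 3 * a\<^sup>2 * b) (2 * a * b\<^sup>2)"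
  unfolding connected_sum_def edges_web_Suc
  by (rule web.sum_weight_core) (use web.spans_core_iff hubs_in_web in simp)

lemma split_sum_Suc:
  "split_sum (Suc n) a b = split_sum n (a ^ 3 + 3 * a\<^sup>2 * b) (2 * a * b\<^sup>2)"
  unfolding split_sum_def edges_web_Suc
proof (rule web.sum_weight_core)
  fix F assume F: "F \<subseteq> \<Union>(web.triangle n ` edges (web n))"
  show "splits (subweb (Suc n) F) \<longleftrightarrow> web.attached n F \<and> splits (subweb n (web.core n F))"
    using web.spans_core_iff[OF F, of "{HubA, HubC}"] web.joined_core_iff[OF F] hubs_in_web[of n]
    by (auto simp: splits_def)
qed

lemma joined_subweb_0_iff:
  "(HubA, HubB) \<in> joined (subweb 0 F) \<longleftrightarrow>
     Upair HubA HubB \<in> F \<or> Upair HubA HubC \<in> F \<and> Upair HubB HubC \<in> F"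
  "(HubA, HubC) \<in> joined (subweb 0 F) \<longleftrightarrow>
     Upair HubA HubC \<in> F \<or> Upair HubA HubB \<in> F \<and> Upair HubB HubC \<in> F"
proof -
  have BC: "Upair HubC HubB = Upair HubB HubC" by simp
  show "(HubA, HubB) \<in> joined (subweb 0 F) \<longleftrightarrow>
      Upair HubA HubB \<in> F \<or> Upair HubA HubC \<in> F \<and> Upair HubB HubC \<in> F"
    using joined_three_vertices_iff[of HubA HubB HubC F] by (simp add: BC)
  show "(HubA, HubC) \<in> joined (subweb 0 F) \<longleftrightarrow>
      Upair HubA HubC \<in> F \<or> Upair HubA HubB \<in> F \<and> Upair HubB HubC \<in> F"
    using joined_three_vertices_iff[of HubA HubC HubB F] by (simp add: insert_commute)
qed

lemma joined_refl: "v \<in> verts G \<Longrightarrow> (v, v) \<in> joined G"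
  by (simp add: joined_def)

lemma
  shows connected_sum_0: "connected_sum 0 a b = a ^ 3 + 3 * a\<^sup>2 * b"
    and split_sum_0: "split_sum 0 a b = a * b\<^sup>2"
proof -
  let ?x = "Upair HubA HubB" and ?y = "Upair HubB HubC" and ?z = "Upair HubA HubC"
  have spans: "spans (subweb 0 F) {HubA} \<longleftrightarrow>
      (HubA, HubB) \<in> joined (subweb 0 F) \<and> (HubA, HubC) \<in> joined (subweb 0 F)" for F
    using joined_refl[of HubA "subweb 0 F"] by (auto simp: spans_def)
  have splits: "splits (subweb 0 F) \<longleftrightarrow>
      (HubA, HubB) \<in> joined (subweb 0 F) \<and> (HubA, HubC) \<notin> joined (subweb 0 F)" for F
    using joined_refl[of HubA "subweb 0 F"] joined_refl[of HubC "subweb 0 F"]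
    by (auto simp: splits_def spans_def)
  have ne: "?x \<noteq> ?y" "?x \<noteq> ?z" "?y \<noteq> ?z" by auto
  have E: "edges (web 0) = {?x, ?y, ?z}" by simp
  show "connected_sum 0 a b = a ^ 3 + 3 * a\<^sup>2 * b"
    unfolding connected_sum_def E spans joined_subweb_0_iff sum_weight_triple[OF ne] using ne by simp
  show "split_sum 0 a b = a * b\<^sup>2"
    unfolding split_sum_def E splits joined_subweb_0_iff sum_weight_triple[OF ne] using ne by simp
qed

text \<open>The weights must stay arbitrary: the hypothesis at the transformed weights is the claim
  for the next index at the original ones. The base case fixes the constants,
  \<open>6 = 3 * 2\<close> and \<open>4 = 2\<^sup>2\<close>, where each 2 comes from the separated
  weight \<open>2 * a * b\<^sup>2\<close> being twice \<open>split_sum 0 a b\<close>.\<close>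

lemma sums_recurrence:
  "connected_sum (Suc n) a b = connected_sum n a b ^ 3 + 6 * (connected_sum n a b)\<^sup>2 * split_sum n a b
   \<and> split_sum (Suc n) a b = 4 * connected_sum n a b * (split_sum n a b)\<^sup>2"
proof (induction n arbitrary: a b)
  case 0
  show ?case
    unfolding connected_sum_Suc split_sum_Suc connected_sum_0 split_sum_0
    by (simp add: power2_eq_square power3_eq_cube algebra_simps)
next
  case (Suc n)
  show ?case
    using Suc[of "a ^ 3 + 3 * a\<^sup>2 * b" "2 * a * b\<^sup>2"]
    by (simp only: connected_sum_Suc[of "Suc n"] split_sum_Suc[of "Suc n"]
        connected_sum_Suc[of n a b] split_sum_Suc[of n a b])
qed

section \<open>Identifying R(n) and B(n) with the weighted sums\<close>

lemma R_web_eq_connected_sum: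
  assumes "0 \<le> p" "p \<le> 1"
  shows "R_web p n = connected_sum n p (1 - p)"
proof -
  have "(\<forall>u\<in>verts (web n). \<forall>v\<in>verts (web n). (u, v) \<in> joined (subweb n F))
      \<longleftrightarrow> spans (subweb n F) {HubA}" for F
    using joined_all_iff_spans[of HubA "subweb n F"] hubs_in_web by simp
  then show ?thesis
    unfolding R_web_def connected_sum_def
    using finite_web assms by (simp add: reliability_eq_sum_weight)
qed

text \<open>With all edges present every apex is attached and the core is the whole previous web, so
  connectedness passes from stage to stage. It yields the rank \<open>V - 1\<close> of the
  web.\<close>

lemma spans_web: "spans (web n) {HubA}"
proof (induction n)
  case 0
  have "subweb 0 (edges (web 0)) = web 0" by simp
  then show ?case
    using joined_subweb_0_iff[of "edges (web 0)"] joined_refl[of HubA "web 0"] by (auto simp: spans_def)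
next
  case (Suc n)
  have "web.core n (edges (web (Suc n))) = edges (web n)"
    by (auto simp: web.core_def)
  moreover have "web.attached n (edges (web (Suc n)))"
    unfolding web.attached_def using web.edge_ends by fastforce
  moreover have full: "subweb k (edges (web k)) = web k" for k by (cases "web k") simp
  moreover have "verts (web (Suc n)) = web.V' n" by simp
  ultimately show ?case
    using web.spans_core_iff[of "edges (web (Suc n))" n "{HubA}"] Suc hubs_in_web edges_web_Suc
    by (metis empty_subsetI insert_subset order_refl)
qed

lemma graph_rank_web: "graph_rank (web n) = card (verts (web n)) - 1"
  using components_eq_if_spans[OF spans_web] hubs_in_web by (simp add: graph_rank_def)

lemma card_web: "2 \<le> card (verts (web n))" "card (verts (web n)) \<le> card (edges (web n))"
proof -
  have "card {HubA, HubB} \<le> card (verts (web n))"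
    using hubs_in_web finite_web by (intro card_mono) auto
  then show "2 \<le> card (verts (web n))" by simp
  show "card (verts (web n)) \<le> card (edges (web n))"
  proof (induction n)
    case 0
    have "Upair HubA HubB \<noteq> Upair HubB HubC" "Upair HubA HubB \<noteq> Upair HubA HubC"
      "Upair HubB HubC \<noteq> Upair HubA HubC" by auto
    then show ?case by simp
  next
    case (Suc n)
    have "card (verts (web (Suc n))) \<le> card (verts (web n)) + card (New n ` edges (web n))"
      by (simp add: card_Un_le)
    also have "\<dots> \<le> 3 * card (edges (web n))"
      using Suc finite_web card_image_le[of "edges (web n)" "New n"] by simp
    finally show ?case unfolding edges_web_Suc web.card_E' .
  qed
qed

text \<open>After one factor \<open>x - 1\<close> is cancelled, a subgraph with \<open>k\<close>
  components carries \<open>(x - 1) ^ (k - 2)\<close>. At \<open>x = 1\<close> only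
  \<open>k = 2\<close> survives, and there the rank is \<open>V - 2\<close>.\<close>

lemma eval2_P2:
  "eval2 (P2 n) 1 y = (\<Sum>F | F \<subseteq> edges (web n) \<and> splits (subweb n F).
     (y - 1) ^ (card F - (card (verts (web n)) - 2)))"
proof -
  let ?V = "verts (web n)"
  let ?k = "\<lambda>H. card (components H)"
  have D2C: "card ?V \<ge> ?k H" "?k H \<ge> 2" "?k H \<le> 2 \<longleftrightarrow> spans H {HubA, HubC}"
    "graph_rank (web n) - graph_rank H = Suc (?k H - 2)" if "H \<in> D2C n" for H
  proof -
    have H: "verts H = ?V" "(HubA, HubC) \<notin> joined H"
      using that by (auto simp: D2C_def spanning_subgraphs_def)
    show k: "card ?V \<ge> ?k H" "?k H \<ge> 2" "?k H \<le> 2 \<longleftrightarrow> spans H {HubA, HubC}"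
      using card_components_if_not_joined[of H HubA HubC] H hubs_in_web finite_web by auto
    \<comment> \<open>The difference is \<open>k - 1\<close>; writing it as a successor exhibits the
      factor to be cancelled.\<close>
    show "graph_rank (web n) - graph_rank H = Suc (?k H - 2)"
      using k by (simp add: graph_rank_web) (simp add: graph_rank_def H)
  qed
  have subweb_edges: "subweb n (edges H) = H" if "H \<in> D2C n" for H
    using that by (cases H) (simp add: D2C_def spanning_subgraphs_def)
  define Q where "Q = (\<Sum>H\<in>D2C n. x_minus_1 ^ (?k H - 2) * y_minus_1 ^ nullity H)"
  have "T2 n = x_minus_1 * Q"
    unfolding T2_def Q_def sum_distrib_left
    by (rule sum.cong[OF refl]) (simp add: D2C(4) mult.assoc)
  then have "x_minus_1 * P2 n = x_minus_1 * Q" using T2_eq by metis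
  moreover have "x_minus_1 \<noteq> 0" by (simp add: x_minus_1_def)
  ultimately have P2: "P2 n = Q" by simp
  have [simp]: "poly x_minus_1 [:1:] = 0" "poly y_minus_1 z = [:-1, 1:]" for z
    by (simp_all add: x_minus_1_def y_minus_1_def)
  have "eval2 (P2 n) 1 y = (\<Sum>H\<in>D2C n. 0 ^ (?k H - 2) * (y - 1) ^ nullity H)"
    by (simp add: P2 Q_def eval2_def poly_sum poly_power)
  also have "\<dots> = (\<Sum>H | H \<in> D2C n \<and> spans H {HubA, HubC}. (y - 1) ^ nullity H)"
  proof -
    have "D2C n \<subseteq> subweb n ` Pow (edges (web n))"
    proof
      fix H assume H: "H \<in> D2C n"
      then have "edges H \<in> Pow (edges (web n))" by (simp add: D2C_def spanning_subgraphs_def)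
      then show "H \<in> subweb n ` Pow (edges (web n))" using subweb_edges[OF H] by (metis imageI)
    qed
    then have "finite (D2C n)" using finite_web by (meson finite_Pow_iff finite_imageI finite_subset)
    then show ?thesis
      \<comment> \<open>The convention \<open>0 ^ 0 = 1\<close> keeps exactly the subgraphs with two
        components.\<close>
      by (intro sum.mono_neutral_cong_right) (use D2C(2,3) in \<open>auto simp: power_0_left\<close>)
  qed
  also have "\<dots> = (\<Sum>F | F \<subseteq> edges (web n) \<and> splits (subweb n F). (y - 1) ^ (card F - (card ?V - 2)))"
  proof (rule sum.reindex_bij_witness[where i = "subweb n" and j = edges])
    fix H assume H: "H \<in> {H \<in> D2C n. spans H {HubA, HubC}}"
    then show eq: "subweb n (edges H) = H" using subweb_edges by simp
    show "edges H \<in> {F. F \<subseteq> edges (web n) \<and> splits (subweb n F)}"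
      using H unfolding mem_Collect_eq eq by (auto simp: D2C_def spanning_subgraphs_def splits_def)
    have "?k H = 2" "verts H = ?V" using H D2C(2,3)[of H]
      by (auto simp: D2C_def spanning_subgraphs_def)
    then show "(y - 1) ^ (card (edges H) - (card ?V - 2)) = (y - 1) ^ nullity H"
      by (simp add: nullity_def graph_rank_def)
  qed (auto simp: D2C_def spanning_subgraphs_def splits_def)
  finally show ?thesis .
qed

lemma B_web_eq_split_sum:
  assumes "p < 1"
  shows "B_web p n = split_sum n p (1 - p)"
proof -
  let ?V = "verts (web n)" and ?E = "edges (web n)"
  \<comment> \<open>At \<open>y = 1 / (1 - p)\<close> the base \<open>y - 1\<close> is the odds
    \<open>p / (1 - p)\<close>, so the prefactor of \<open>B_web\<close> turns each term into the
    probability of its edge set.\<close>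
  have q: "1 - p \<noteq> 0" "1 / (1 - p) - 1 = p / (1 - p)" using assms by (auto simp: field_simps)
  have "p ^ (card ?V - 2) * (1 - p) ^ (card ?E - card ?V + 2) * (p / (1 - p)) ^ (card F - (card ?V - 2))
      = weight ?E p (1 - p) F"
    if F: "F \<subseteq> ?E" "splits (subweb n F)" for F
  proof -
    have "card {HubA, HubC} = 2" "finite F" using F finite_web finite_subset by auto
    then have le: "card ?V \<le> 2 + card F" "card F \<le> card ?E"
      using card_verts_le_spans[of "subweb n F" "{HubA, HubC}"] F finite_web
      by (auto simp: splits_def intro: card_mono)
    \<comment> \<open>\<open>m\<close> is the nullity of the subgraph; by \<open>le\<close> its
      subtraction is not truncated.\<close>
    define m where "m = card F - (card ?V - 2)"
    have "card ?E - card ?V + 2 = (card ?E - card F) + m" "card F = (card ?V - 2) + m"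
      using le card_web[of n] by (auto simp: m_def)
    then have "weight ?E p (1 - p) F = p ^ (card ?V - 2) * p ^ m * (1 - p) ^ (card ?E - card F)"
      and "(1 - p) ^ (card ?E - card ?V + 2) = (1 - p) ^ (card ?E - card F) * (1 - p) ^ m"
      using F finite_web by (simp_all add: weight_eq_powers flip: power_add)
    then show ?thesis using q unfolding m_def[symmetric] by (simp add: power_divide)
  qed
  then show ?thesis
    unfolding B_web_def eval2_P2 split_sum_def q sum_distrib_left by (intro sum.cong) auto
qed

theorem mainTheorem4:
  fixes p :: real
  assumes "0 \<le> p" and "p < 1"
  shows "R_web p 0 = p\<^sup>2 * (3 - 2 * p)
    \<and> B_web p 0 = p * (1 - p)\<^sup>2
    \<and> (\<forall>n. R_web p (Suc n) = R_web p n ^ 3 + 6 * (R_web p n)\<^sup>2 * B_web p n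
          \<and> B_web p (Suc n) = 4 * R_web p n * (B_web p n)\<^sup>2)"
proof -
  have RB: "R_web p n = connected_sum n p (1 - p)" "B_web p n = split_sum n p (1 - p)" for n
    using R_web_eq_connected_sum[OF assms(1) less_imp_le[OF assms(2)]]
      B_web_eq_split_sum[OF assms(2)] by blast+
  have "R_web p 0 = p\<^sup>2 * (3 - 2 * p)"
    unfolding RB connected_sum_0 by (simp add: power2_eq_square power3_eq_cube algebra_simps)
  moreover have "B_web p 0 = p * (1 - p)\<^sup>2" unfolding RB split_sum_0 ..
  ultimately show ?thesis using sums_recurrence unfolding RB by blast
qed

end
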